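(* Let $d,s,M\in\mathbb{N}$ with $d\ge 2$ and $s\le d$, and let $L\subset\mathbb{T}^d$ be a rank-$s$ lattice of size $M$. Then there exist distinct $\boldsymbol k^1,\boldsymbol k^2\in \operatorname{X}^d_{\sqrt M}$ with $e^{2\pi i\boldsymbol k^1\cdot\boldsymbol x}=e^{2\pi i\boldsymbol k^2\cdot\boldsymbol x}$ for all $\boldsymbol x\in L$. Consequently, if $\alpha,\beta,\gamma\in\mathbb{R}$ satisfy $\alpha>\gamma-\beta\ge0$ and $\alpha+\beta>\frac12$, then for $Y=\mathcal{H}^{\gamma}(\mathbb{T}^d)$ and for $Y=\mathcal{H}^{\gamma}_{\mathrm{mix}}(\mathbb{T}^d)$ $$\operatorname{Samp}_{L}(\mathcal{H}^{\alpha,\beta}(\mathbb{T}^d),Y)\ \ge\ 2^{-(\alpha+\beta-\gamma+1)/2}\,M^{-(\alpha+\beta-\gamma)/2}.$$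
   Context: $\mathbb{T}=[0,1)$ is the torus, identified with $\mathbb{R}/\mathbb{Z}$. A rank-$s$ lattice of size $M$ (node set of a rank-$s$ lattice rule) is a finite subgroup $L$ of $\mathbb{T}^d$ of order $M$ whose minimal number of generators is $s$. The two-dimensional axis cross is $$\operatorname{X}^d_{\sqrt M}:=\{\boldsymbol h\in\mathbb{Z}^2\times\{0\}^{d-2}:\ \|\boldsymbol h\|_1=\|\boldsymbol h\|_\infty\le\sqrt M\}.$$ With $\hat f_{\boldsymbol k}=\int_{\mathbb{T}^d}f(\boldsymbol x)e^{-2\pi i\boldsymbol k\cdot\boldsymbol x}\,d\boldsymbol x$, for real $\alpha,\beta$, $\mathcal{H}^{\alpha,\beta}(\mathbb{T}^d)$ is the space of $f\in L_2(\mathbb{T}^d)$ with finite norm $$\|f|\mathcal{H}^{\alpha,\beta}(\mathbb{T}^d)\|^2=\sum_{\boldsymbol k\in\mathbb{Z}^d}|\hat f_{\boldsymbol k}|^2(1+\|\boldsymbol k\|_2^2)^{\beta}\prod_{s=1}^d(1+|k_s|^2)^{\alpha},$$ $\mathcal{H}^{\gamma}(\mathbb{T}^d):=\mathcal{H}^{0,\gamma}(\mathbb{T}^d)$, $\mathcal{H}^{\gamma}_{\mathrm{mix}}(\mathbb{T}^d):=\mathcal{H}^{\gamma,0}(\mathbb{T}^d)$. For $L=\{\boldsymbol x_0,\dots,\boldsymbol x_{M-1}\}$, $$\operatorname{Samp}_{L}(\mathcal F,Y):=\inf_{A:\mathbb{C}^M\to Y}\ \sup_{\|f|\mathcal F\|\le1}\big\|f-A\big((f(\boldsymbol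 x_j))_{j=0}^{M-1}\big)\big\|_Y,$$ where $A$ ranges over all (possibly non-linear) maps. Function values refer to the continuous representative; the supremum is over those $f$ in the unit ball of $\mathcal F$ that have one (all of them when $\min\{\alpha,\alpha+\beta\}>\frac12$). The norm $\|\cdot\|_Y$ is set to $+\infty$ outside $Y$. *)

theory Defs
  imports
    "HOL-Analysis.Analysis"
    "HOL-Algebra.Generated_Groups"
    "HOL-Algebra.Product_Groups"
begin

text \<open>
  Points of the torus and frequency vectors are functions on the index set \<open>{1..d}\<close> in the
  sense of \<open>\<Pi>\<^sub>E\<close>, so that the dimension is an ordinary natural number and coordinates
  1 and 2 are available for the axis cross.
\<close>

definition circle_group :: "real monoid" where
  "circle_group = \<lparr>carrier = {0..<1}, mult = (\<lambda>x y. frac (x + y)), one = 0\<rparr>"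

definition torus_group :: "nat \<Rightarrow> (nat \<Rightarrow> real) monoid" where
  "torus_group d = product_group {1..d} (\<lambda>_. circle_group)"

definition min_generators :: "('a, 'b) monoid_scheme \<Rightarrow> 'a set \<Rightarrow> nat" where
  "min_generators G H =
     (LEAST n. \<exists>S. S \<subseteq> H \<and> finite S \<and> card S = n \<and> generate G S = H)"

definition rank_lattice :: "nat \<Rightarrow> nat \<Rightarrow> nat \<Rightarrow> (nat \<Rightarrow> real) set \<Rightarrow> bool" where
  "rank_lattice d s M L \<longleftrightarrow>
     subgroup L (torus_group d) \<and> finite L \<and> card L = M \<and> min_generators (torus_group d) L = s"

definition int_vectors :: "nat \<Rightarrow> (nat \<Rightarrow> int) set" where
  "int_vectors d = ({1..d} \<rightarrow>\<^sub>E UNIV)"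

definition axis_cross :: "nat \<Rightarrow> real \<Rightarrow> (nat \<Rightarrow> int) set" where
  "axis_cross d R =
     {h \<in> int_vectors d. (\<forall>i\<in>{3..d}. h i = 0) \<and>
        (\<Sum>i=1..d. \<bar>h i\<bar>) = Max ((\<lambda>i. \<bar>h i\<bar>) ` {1..d}) \<and>
        real_of_int (Max ((\<lambda>i. \<bar>h i\<bar>) ` {1..d})) \<le> R}"

definition dot :: "nat \<Rightarrow> (nat \<Rightarrow> int) \<Rightarrow> (nat \<Rightarrow> real) \<Rightarrow> real" where
  "dot d k x = (\<Sum>i=1..d. real_of_int (k i) * x i)"

definition torus_measure :: "nat \<Rightarrow> (nat \<Rightarrow> real) measure" where
  "torus_measure d = (\<Pi>\<^sub>M i\<in>{1..d}. restrict_space lborel {0..<1})"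

definition torus_L2 :: "nat \<Rightarrow> ((nat \<Rightarrow> real) \<Rightarrow> complex) set" where
  "torus_L2 d = {f \<in> borel_measurable (torus_measure d).
                   integrable (torus_measure d) (\<lambda>x. (cmod (f x))\<^sup>2)}"

definition fourier_coeff ::
    "nat \<Rightarrow> ((nat \<Rightarrow> real) \<Rightarrow> complex) \<Rightarrow> (nat \<Rightarrow> int) \<Rightarrow> complex" where
  "fourier_coeff d f k =
     (LINT x|torus_measure d. f x * exp (- 2 * of_real pi * \<i> * of_real (dot d k x)))"

definition H_weight :: "nat \<Rightarrow> real \<Rightarrow> real \<Rightarrow> (nat \<Rightarrow> int) \<Rightarrow> real" where
  "H_weight d \<alpha> \<beta> k =
     (1 + (\<Sum>i=1..d. (real_of_int (k i))\<^sup>2)) powr \<beta> *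
     (\<Prod>i=1..d. (1 + \<bar>real_of_int (k i)\<bar>\<^sup>2) powr \<alpha>)"

definition H_space :: "nat \<Rightarrow> real \<Rightarrow> real \<Rightarrow> ((nat \<Rightarrow> real) \<Rightarrow> complex) set" where
  "H_space d \<alpha> \<beta> =
     {f \<in> torus_L2 d.
        (\<lambda>k. (cmod (fourier_coeff d f k))\<^sup>2 * H_weight d \<alpha> \<beta> k) summable_on int_vectors d}"

text \<open>Norms are extended by \<open>\<infinity>\<close> outside the space, so a norm also determines its space.\<close>

definition H_norm :: "nat \<Rightarrow> real \<Rightarrow> real \<Rightarrow> ((nat \<Rightarrow> real) \<Rightarrow> complex) \<Rightarrow> ennreal" where
  "H_norm d \<alpha> \<beta> f =
     (if f \<in> H_space d \<alpha> \<beta>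
      then ennreal (sqrt (\<Sum>\<^sub>\<infinity>k\<in>int_vectors d.
                            (cmod (fourier_coeff d f k))\<^sup>2 * H_weight d \<alpha> \<beta> k))
      else \<infinity>)"

definition H_iso_norm :: "nat \<Rightarrow> real \<Rightarrow> ((nat \<Rightarrow> real) \<Rightarrow> complex) \<Rightarrow> ennreal" where
  "H_iso_norm d \<gamma> = H_norm d 0 \<gamma>"

definition H_mix_norm :: "nat \<Rightarrow> real \<Rightarrow> ((nat \<Rightarrow> real) \<Rightarrow> complex) \<Rightarrow> ennreal" where
  "H_mix_norm d \<gamma> = H_norm d \<gamma> 0"

text \<open>
  Continuity on \<open>[0,1)\<^sup>d\<close> is with respect to the topology of \<open>\<real>\<^sup>d/\<int>\<^sup>d\<close>, that is,
  continuity of the 1-periodic extension to \<open>\<real>\<^sup>d\<close>.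
\<close>

definition torus_continuous :: "nat \<Rightarrow> ((nat \<Rightarrow> real) \<Rightarrow> complex) \<Rightarrow> bool" where
  "torus_continuous d g \<longleftrightarrow>
     continuous_map (product_topology (\<lambda>_. euclideanreal) {1..d}) euclidean
       (\<lambda>x. g (\<lambda>i\<in>{1..d}. frac (x i)))"

definition continuous_rep ::
    "nat \<Rightarrow> ((nat \<Rightarrow> real) \<Rightarrow> complex) \<Rightarrow> ((nat \<Rightarrow> real) \<Rightarrow> complex) \<Rightarrow> bool" where
  "continuous_rep d f g \<longleftrightarrow> torus_continuous d g \<and> (AE x in torus_measure d. f x = g x)"

text \<open>
  The arguments \<open>F\<close> and \<open>Y\<close> are extended norms. Data vectors are indexed by the points of \<open>L\<close>
  instead of an enumeration of them, i.e. \<open>\<complex>\<^sup>M\<close> is \<open>L \<rightarrow>\<^sub>E UNIV\<close>.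
\<close>

definition samp ::
    "nat \<Rightarrow> (nat \<Rightarrow> real) set \<Rightarrow> (((nat \<Rightarrow> real) \<Rightarrow> complex) \<Rightarrow> ennreal) \<Rightarrow>
     (((nat \<Rightarrow> real) \<Rightarrow> complex) \<Rightarrow> ennreal) \<Rightarrow> ennreal" where
  "samp d L F Y =
     (INF A \<in> (L \<rightarrow>\<^sub>E (UNIV :: complex set)) \<rightarrow> {h. Y h < \<infinity>}.
        SUP (f, g) \<in> {(f, g). F f \<le> 1 \<and> continuous_rep d f g}.
          Y (\<lambda>x. f x - A (restrict g L) x))"

end

theory Submission
  imports Defs
begin

text \<open>
  Characters of a finite group that differ as functions are orthogonal, so at most \<open>M\<close> of them
  exist on \<open>L\<close>; hence two of the more than \<open>M\<close> frequencies in \<open>{0..\<lfloor>\<surd>M\<rfloor>}\<^sup>2\<close> coincide on \<open>L\<close>, and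
  their difference \<open>(a, b)\<close> yields the aliasing pair \<open>(a, 0)\<close>, \<open>(0, -b)\<close> in the axis cross.
  The normalised difference \<open>f\<close> of the two exponentials then vanishes on \<open>L\<close>, so \<open>f\<close> and \<open>-f\<close>
  cannot be distinguished from their samples and the error is at least \<open>\<parallel>f\<parallel>\<^sub>Y\<close>. On the axes every
  weight is a power of \<open>1 + n\<^sup>2 \<le> 1 + M \<le> 2 M\<close>, which gives the bound.
\<close>

subsection \<open>Characters of the torus\<close>

definition torus_char :: "nat \<Rightarrow> (nat \<Rightarrow> int) \<Rightarrow> (nat \<Rightarrow> real) \<Rightarrow> complex" where
  "torus_char d k x = cis (2 * pi * dot d k x)"

lemma exp_dot: "exp (2 * of_real pi * \<i> * of_real (dot d k x)) = torus_char d k x"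
  by (simp add: torus_char_def cis_conv_exp algebra_simps)

lemma exp_minus_dot: "exp (- 2 * of_real pi * \<i> * of_real (dot d k x)) = cnj (torus_char d k x)"
proof -
  have "cnj (torus_char d k x) = cis (- (2 * pi * dot d k x))"
    by (simp add: torus_char_def cis_cnj)
  then show ?thesis
    by (simp add: cis_conv_exp algebra_simps)
qed

lemma norm_torus_char [simp]: "cmod (torus_char d k x) = 1"
  by (simp add: torus_char_def)

text \<open>Factoring over coordinates makes it possible to remove fractional parts one coordinate
  at a time and to integrate by Fubini.\<close>

lemma torus_char_prod: "torus_char d k x = (\<Prod>i\<in>{1..d}. cis (2 * pi * (of_int (k i) * x i)))"
proof -
  have "cis (sum g A) = (\<Prod>i\<in>A. cis (g i))" if "finite A" for g :: "nat \<Rightarrow> real" and A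
    using that by induction (simp_all flip: cis_mult)
  then show ?thesis
    by (simp add: torus_char_def dot_def sum_distrib_left)
qed

lemma torus_char_diff:
  "torus_char d k x * cnj (torus_char d l x) = torus_char d (\<lambda>i. k i - l i) x"
  by (simp add: torus_char_def cis_cnj cis_mult dot_def sum_subtractf algebra_simps)

lemma torus_char_cong:
  assumes "\<And>i. i \<in> {1..d} \<Longrightarrow> k i = l i"
  shows "torus_char d k x = torus_char d l x"
  using assms by (simp add: torus_char_prod)

lemma cis_frac: "cis (2 * pi * (of_int n * frac t)) = cis (2 * pi * (of_int n * t))"
proof -
  \<comment> \<open>Since \<open>t\<close> is \<open>frac t\<close> plus an integer, the extra
    factor is \<open>cis\<close> at an integer multiple of 2 pi.\<close>
  have "cis (2 * pi * (of_int n * t)) =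
      cis (2 * pi * (of_int n * frac t)) * cis (2 * pi * of_int (n * \<lfloor>t\<rfloor>))"
    by (simp add: cis_mult frac_def algebra_simps)
  then show ?thesis
    by (simp add: cis_multiple_2pi del: of_int_mult)
qed

text \<open>Invariance under reduction modulo 1 yields both the homomorphism property on the torus
  and the continuity of the periodic extension.\<close>

lemma torus_char_frac: "torus_char d k (\<lambda>i\<in>{1..d}. frac (x i)) = torus_char d k x"
  unfolding torus_char_prod by (intro prod.cong) (auto simp: cis_frac)

lemma torus_char_mult:
  "torus_char d k (x \<otimes>\<^bsub>torus_group d\<^esub> y) = torus_char d k x * torus_char d k y"
proof -
  have "x \<otimes>\<^bsub>torus_group d\<^esub> y = (\<lambda>i\<in>{1..d}. frac (x i + y i))"
    by (simp add: torus_group_def circle_group_def)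
  then have "torus_char d k (x \<otimes>\<^bsub>torus_group d\<^esub> y) = torus_char d k (\<lambda>i. x i + y i)"
    by (simp only: torus_char_frac)
  then show ?thesis
    by (simp add: torus_char_def dot_def cis_mult sum.distrib algebra_simps)
qed

section \<open>Group structure of the torus and character sums\<close>

lemma group_circle_group: "group circle_group"
proof (rule groupI)
  fix x assume "x \<in> carrier circle_group"
  then show "\<exists>y\<in>carrier circle_group. y \<otimes>\<^bsub>circle_group\<^esub> x = \<one>\<^bsub>circle_group\<^esub>"
    by (intro bexI [of _ "frac (- x)"])
       (auto simp: circle_group_def frac_lt_1 frac_add_simps)
next
  fix x y z
  show "x \<otimes>\<^bsub>circle_group\<^esub> y \<otimes>\<^bsub>circle_group\<^esub> z = x \<otimes>\<^bsub>circle_group\<^esub> (y \<otimes>\<^bsub>circle_group\<^esub> z)"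
    by (simp add: circle_group_def frac_add_simps add.assoc)
qed (auto simp: circle_group_def frac_lt_1 frac_eq)

lemma group_torus_group: "group (torus_group d)"
  unfolding torus_group_def by (simp add: group_circle_group)

text \<open>Translation by \<open>y\<close> permutes \<open>L\<close> and multiplies the sum by
  \<open>torus_char d k y\<close>, which differs from 1.\<close>

lemma sum_torus_char_eq_0:
  assumes L: "subgroup L (torus_group d)" and y: "y \<in> L" "torus_char d k y \<noteq> 1"
  shows "(\<Sum>x\<in>L. torus_char d k x) = 0"
proof -
  interpret T: group "torus_group d" by (rule group_torus_group)
  let ?t = "\<lambda>x. y \<otimes>\<^bsub>torus_group d\<^esub> x"
  have "bij_betw ?t L L"
  proof (rule bij_betw_byWitness [where f' = "\<lambda>x. inv\<^bsub>torus_group d\<^esub> y \<otimes>\<^bsub>torus_group d\<^esub> x"])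
    have L': "L \<subseteq> carrier (torus_group d)" using L by (rule subgroup.subset)
    show "\<forall>a\<in>L. inv\<^bsub>torus_group d\<^esub> y \<otimes>\<^bsub>torus_group d\<^esub> ?t a = a"
      "\<forall>a\<in>L. ?t (inv\<^bsub>torus_group d\<^esub> y \<otimes>\<^bsub>torus_group d\<^esub> a) = a"
      using L' y by (auto simp: subset_iff T.m_assoc [symmetric])
    show "?t ` L \<subseteq> L" "(\<lambda>x. inv\<^bsub>torus_group d\<^esub> y \<otimes>\<^bsub>torus_group d\<^esub> x) ` L \<subseteq> L"
      using L y by (auto intro: subgroup.m_closed subgroup.m_inv_closed)
  qed
  then have "(\<Sum>x\<in>L. torus_char d k x) = (\<Sum>x\<in>L. torus_char d k (?t x))"
    by (rule sum.reindex_bij_betw [symmetric])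
  also have "\<dots> = torus_char d k y * (\<Sum>x\<in>L. torus_char d k x)"
    by (simp add: torus_char_mult sum_distrib_left)
  finally show ?thesis using y by simp
qed

text \<open>
  By orthogonality, \<open>\<Sum>\<^sub>x\<^sub>\<in>\<^sub>L |\<Sum>\<^sub>k\<^sub>\<in>\<^sub>K \<chi>\<^sub>k x|\<^sup>2 = |K| |L|\<close>; the term at the unit alone is \<open>|K|\<^sup>2\<close>.
\<close>

lemma card_torus_chars_le:
  assumes L: "subgroup L (torus_group d)" "finite L" and K: "finite K"
    and sep: "\<And>k l. k \<in> K \<Longrightarrow> l \<in> K \<Longrightarrow> k \<noteq> l \<Longrightarrow> \<exists>x\<in>L. torus_char d k x \<noteq> torus_char d l x"
  shows "card K \<le> card L"
proof (cases "K = {}")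
  case False
  let ?S = "\<lambda>x. \<Sum>k\<in>K. torus_char d k x"
  have orth: "(\<Sum>x\<in>L. torus_char d k x * cnj (torus_char d l x)) = (if k = l then of_nat (card L) else 0)"
    if kl: "k \<in> K" "l \<in> K" for k l
  proof (cases "k = l")
    case True
    then show ?thesis by (simp add: complex_norm_square [symmetric])
  next
    case False
    then obtain y where y: "y \<in> L" "torus_char d k y \<noteq> torus_char d l y"
      using sep kl by blast
    \<comment> \<open>As \<open>torus_char d l y\<close> has modulus 1, multiplying by it cancels
      its conjugate; hence the quotient character is nontrivial at \<open>y\<close>.\<close>
    have "torus_char d k y * cnj (torus_char d l y) * torus_char d l y = torus_char d k y"
      by (simp add: mult.assoc complex_norm_square [symmetric] mult.commute [of "cnj _"])
    then have "torus_char d (\<lambda>i. k i - l i) y \<noteq> 1"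
      unfolding torus_char_diff using y by auto
    then show ?thesis
      using sum_torus_char_eq_0 [OF L(1) y(1)] False by (simp add: torus_char_diff)
  qed
  have "complex_of_real (\<Sum>x\<in>L. (cmod (?S x))\<^sup>2) = (\<Sum>x\<in>L. ?S x * cnj (?S x))"
    by (simp only: of_real_sum complex_norm_square)
  also have "\<dots> = (\<Sum>x\<in>L. \<Sum>k\<in>K. \<Sum>l\<in>K. torus_char d k x * cnj (torus_char d l x))"
    by (simp add: sum_product)
  also have "\<dots> = (\<Sum>k\<in>K. \<Sum>l\<in>K. \<Sum>x\<in>L. torus_char d k x * cnj (torus_char d l x))"
    by (subst sum.swap) (intro sum.cong refl sum.swap)
  also have "\<dots> = of_nat (card K) * of_nat (card L)"
    using K by (simp add: orth)
  also have "\<dots> = complex_of_real (real (card K) * real (card L))"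
    by simp
  finally have eq: "(\<Sum>x\<in>L. (cmod (?S x))\<^sup>2) = real (card K) * real (card L)"
    by (simp only: of_real_eq_iff)
  have one: "\<one>\<^bsub>torus_group d\<^esub> \<in> L" using L(1) by (rule subgroup.one_closed)
  have "torus_char d k \<one>\<^bsub>torus_group d\<^esub> = 1" for k
    by (simp add: torus_char_prod torus_group_def circle_group_def)
  then have "(real (card K))\<^sup>2 = (cmod (?S \<one>\<^bsub>torus_group d\<^esub>))\<^sup>2"
    by simp
  also have "\<dots> \<le> (\<Sum>x\<in>L. (cmod (?S x))\<^sup>2)"
    using L(2) one by (intro member_le_sum) auto
  finally have "real (card K) * real (card K) \<le> real (card K) * real (card L)"
    unfolding eq by (simp only: power2_eq_square)
  moreover have "card K > 0" using K False by (simp add: card_gt_0_iff)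
  ultimately show ?thesis by simp
qed simp

subsection \<open>Aliasing on the axis cross\<close>

text \<open>Restriction to \<open>{1..d}\<close> makes the vector extensional, as
  \<open>int_vectors\<close> requires.\<close>

definition axis_vector :: "nat \<Rightarrow> nat \<Rightarrow> int \<Rightarrow> nat \<Rightarrow> int" where
  "axis_vector d j a = (\<lambda>i\<in>{1..d}. if i = j then a else 0)"

lemma axis_vector_in_axis_cross:
  assumes "j \<in> {1,2}" "d \<ge> 2" "real_of_int \<bar>a\<bar> \<le> R"
  shows "axis_vector d j a \<in> axis_cross d R"
proof -
  have j: "j \<in> {1..d}" using assms by auto
  have "Max ((\<lambda>i. \<bar>axis_vector d j a i\<bar>) ` {1..d}) = \<bar>a\<bar>"
  proof (rule Max_eqI)
    show "\<bar>a\<bar> \<in> (\<lambda>i. \<bar>axis_vector d j a i\<bar>) ` {1..d}"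
      using j by (intro image_eqI [of _ _ j]) (auto simp: axis_vector_def)
  qed (auto simp: axis_vector_def)
  moreover have "(\<Sum>i=1..d. \<bar>axis_vector d j a i\<bar>) = \<bar>a\<bar>"
    using j by (simp add: axis_vector_def if_distrib [of abs] cong: if_cong)
  moreover have "\<forall>i\<in>{3..d}. axis_vector d j a i = 0"
    using assms(1) by (auto simp: axis_vector_def)
  ultimately show ?thesis
    using assms(3) unfolding axis_cross_def int_vectors_def
    by (auto simp: axis_vector_def)
qed

lemma axis_cross_aliasing:
  assumes L: "subgroup L (torus_group d)" "finite L" and d: "d \<ge> 2"
  obtains k l where "k \<in> axis_cross d (sqrt (real (card L)))"
    "l \<in> axis_cross d (sqrt (real (card L)))" "k \<noteq> l"
    "\<And>x. x \<in> L \<Longrightarrow> torus_char d k x = torus_char d l x"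
proof -
  \<comment> \<open>Rounding down keeps differences of grid entries within the radius, while
    \<open>(m + 1)\<^sup>2\<close> still strictly exceeds the order of \<open>L\<close>.\<close>
  define m where "m = nat \<lfloor>sqrt (real (card L))\<rfloor>"
  have m: "real m \<le> sqrt (real (card L))"
    unfolding m_def by (simp add: of_nat_floor)
  have "sqrt (real (card L)) < real m + 1"
    unfolding m_def by linarith
  then have "(sqrt (real (card L)))\<^sup>2 < (real m + 1)\<^sup>2" by (intro power_strict_mono) auto
  then have "real (card L) < real ((m + 1)\<^sup>2)" by (simp add: add.commute)
  then have card_less: "card L < (m + 1)\<^sup>2" by (simp only: of_nat_less_iff)
  \<comment> \<open>The grid vectors are 0, not \<open>undefined\<close>, outside
    \<open>{1..d}\<close>; characters read only the indices in \<open>{1..d}\<close>.\<close>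
  define h where "h = (\<lambda>(a, b) (i::nat). if i = 1 then a else if i = 2 then b else 0 :: int)"
  define K where "K = h ` ({0..int m} \<times> {0..int m})"
  have "inj h"
  proof (rule injI)
    fix p q assume "h p = h q"
    then have "h p 1 = h q 1" "h p 2 = h q 2" by simp_all
    then show "p = q" by (simp add: h_def split: prod.splits)
  qed
  then have "card K = (m + 1)\<^sup>2"
    unfolding K_def by (subst card_image) (auto intro: inj_on_subset simp: power2_eq_square nat_add_distrib)
  with card_less have "\<not> card K \<le> card L" by simp
  moreover have "finite K" by (simp add: K_def)
  ultimately obtain p q where
    pq: "p \<in> K" "q \<in> K" "p \<noteq> q" "\<And>x. x \<in> L \<Longrightarrow> torus_char d p x = torus_char d q x"
    using card_torus_chars_le [OF L, of K] by blast
  then obtain a b a' b' where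
    ab: "p = h (a, b)" "q = h (a', b')" "a \<in> {0..int m}" "b \<in> {0..int m}" "a' \<in> {0..int m}" "b' \<in> {0..int m}"
    unfolding K_def by blast
  \<comment> \<open>On \<open>{1..d}\<close> the difference of \<open>?k\<close> and
    \<open>?l\<close> is that of \<open>p\<close> and \<open>q\<close>, so the coincidence on
    \<open>L\<close> carries over to vectors on the two axes.\<close>
  let ?k = "axis_vector d 1 (a - a')" and ?l = "axis_vector d 2 (b' - b)"
  show thesis
  proof (rule that [of ?k ?l])
    have "\<bar>a - a'\<bar> \<le> int m" "\<bar>b' - b\<bar> \<le> int m" using ab by auto
    then have "real_of_int \<bar>a - a'\<bar> \<le> real m" "real_of_int \<bar>b' - b\<bar> \<le> real m" by linarith+
    with m show "?k \<in> axis_cross d (sqrt (real (card L)))" "?l \<in> axis_cross d (sqrt (real (card L)))"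
      by (auto intro!: axis_vector_in_axis_cross d)
    show "?k \<noteq> ?l"
    proof
      assume "?k = ?l"
      \<comment> \<open>The two axes meet only at 0, so equality would give \<open>a = a'\<close>
        and \<open>b = b'\<close>, hence \<open>p = q\<close>.\<close>
      then have "?k 1 = ?l 1" "?k 2 = ?l 2" by simp_all
      then show False using pq(3) ab(1,2) d by (auto simp: axis_vector_def)
    qed
    fix x assume x: "x \<in> L"
    have "torus_char d ?k x * cnj (torus_char d ?l x) = torus_char d p x * cnj (torus_char d q x)"
      unfolding torus_char_diff
      by (rule torus_char_cong) (auto simp: axis_vector_def ab h_def)
    also have "\<dots> = 1"
      using pq(4) [OF x] by (simp add: complex_norm_square [symmetric])
    finally have "torus_char d ?k x * (cnj (torus_char d ?l x) * torus_char d ?l x) = torus_char d ?l x"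
      by (simp add: mult.assoc [symmetric])
    then show "torus_char d ?k x = torus_char d ?l x"
      by (simp add: complex_norm_square [symmetric] mult.commute [of "cnj _"])
  qed
qed

text \<open>Equality of the sum and maximum norms leaves at most one nonzero coordinate, so both
  factors of the weight are powers of the same \<open>1 + n\<^sup>2\<close>. As \<open>n\<close> is
  chosen before the exponents, it serves the source and target norms at once.\<close>

lemma H_weight_axis_cross:
  assumes k: "k \<in> axis_cross d R" and d: "d \<ge> 1"
  obtains n :: real where "0 \<le> n" "n \<le> R" "\<And>\<alpha> \<beta>. H_weight d \<alpha> \<beta> k = (1 + n\<^sup>2) powr (\<alpha> + \<beta>)"
proof -
  have "Max ((\<lambda>i. \<bar>k i\<bar>) ` {1..d}) \<in> (\<lambda>i. \<bar>k i\<bar>) ` {1..d}"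
    using d by (intro Max_in) auto
  then obtain j where j: "j \<in> {1..d}" "Max ((\<lambda>i. \<bar>k i\<bar>) ` {1..d}) = \<bar>k j\<bar>"
    by blast
  have "(\<Sum>i=1..d. \<bar>k i\<bar>) = \<bar>k j\<bar>"
    using k by (simp add: axis_cross_def flip: j(2))
  then have "(\<Sum>i\<in>{1..d} - {j}. \<bar>k i\<bar>) = 0"
    using sum.remove [OF finite_atLeastAtMost j(1), of "\<lambda>i. \<bar>k i\<bar>"] by linarith
  then have 0: "k i = 0" if "i \<in> {1..d} - {j}" for i
    using that by (subst (asm) sum_nonneg_eq_0_iff) auto
  show thesis
  proof (rule that [of "\<bar>real_of_int (k j)\<bar>"])
    show "\<bar>real_of_int (k j)\<bar> \<le> R"
      using k j(2) by (simp add: axis_cross_def)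
    fix \<alpha> \<beta> :: real
    have "(\<Sum>i=1..d. (real_of_int (k i))\<^sup>2) = (\<Sum>i\<in>{j}. (real_of_int (k i))\<^sup>2)"
      using j(1) 0 by (intro sum.mono_neutral_right) auto
    moreover have "(\<Prod>i=1..d. (1 + \<bar>real_of_int (k i)\<bar>\<^sup>2) powr \<alpha>) =
        (\<Prod>i\<in>{j}. (1 + \<bar>real_of_int (k i)\<bar>\<^sup>2) powr \<alpha>)"
      using j(1) 0 by (intro prod.mono_neutral_right) auto
    ultimately show "H_weight d \<alpha> \<beta> k = (1 + \<bar>real_of_int (k j)\<bar>\<^sup>2) powr (\<alpha> + \<beta>)"
      by (simp add: H_weight_def powr_add mult.commute)
  qed simp
qed

subsection \<open>Fourier coefficients\<close>

lemma product_sigma_finite_unit_interval: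
  "product_sigma_finite (\<lambda>_::nat. restrict_space lborel {0..<1::real})"
proof (unfold product_sigma_finite_def, rule allI)
  have "finite_measure (restrict_space lborel {0..<1::real})"
    by (rule finite_measureI) (simp add: emeasure_restrict_space)
  then show "sigma_finite_measure (restrict_space lborel {0..<1::real})"
    by (rule finite_measure.axioms)
qed

lemma integrable_cis_unit_interval:
  "integrable (restrict_space lborel {0..<1}) (\<lambda>t. cis (2 * pi * (of_int n * t)))"
proof -
  interpret finite_measure "restrict_space lborel {0..<1::real}"
    by (rule finite_measureI) (simp add: emeasure_restrict_space)
  have "continuous_on UNIV (\<lambda>t. cis (2 * pi * (of_int n * t)))"
    by (intro continuous_intros)
  then have "(\<lambda>t. cis (2 * pi * (of_int n * t))) \<in> borel_measurable lborel"
    by (simp add: borel_measurable_continuous_onI)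
  then show ?thesis
    by (intro integrable_const_bound [of _ 1]) (auto intro: measurable_restrict_space1)
qed

lemma integral_cis_unit_interval:
  "(LINT t|restrict_space lborel {0..<1}. cis (2 * pi * (of_int n * t))) = (if n = 0 then 1 else 0)"
proof (cases "n = 0")
  case True
  then show ?thesis by (simp add: measure_restrict_space)
next
  case False
  let ?c = "2 * pi * of_int n"
  \<comment> \<open>An antiderivative of the integrand; it takes equal values at 0 and 1 because
    \<open>n\<close> is an integer.\<close>
  let ?F = "\<lambda>t. cis (?c * t) / (\<i> * of_real ?c)"
  have c: "?c \<noteq> 0" using False by simp
  have "(LINT t|restrict_space lborel {0..<1}. cis (2 * pi * (of_int n * t))) =
      (LINT t|lborel. indicator {0..<1} t *\<^sub>R cis (?c * t))"
    by (simp add: integral_restrict_space mult.assoc)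
  \<comment> \<open>The fundamental theorem of calculus is applied on the closed interval; the added
    endpoint is a null set.\<close>
  also have "\<dots> = (LINT t|lborel. indicator {0..1} t *\<^sub>R cis (?c * t))"
  proof (rule integral_cong_AE)
    have "AE t in lborel. t \<noteq> (1::real)" by (rule AE_lborel_singleton)
    then show "AE t in lborel. indicator {0..<1} t *\<^sub>R cis (?c * t) = indicator {0..1} t *\<^sub>R cis (?c * t)"
      by eventually_elim (auto simp: indicator_def)
    have "continuous_on UNIV (\<lambda>t. cis (?c * t))"
      by (intro continuous_intros)
    then have [measurable]: "(\<lambda>t. cis (?c * t)) \<in> borel_measurable borel"
      by (rule borel_measurable_continuous_onI)
    show "(\<lambda>t. indicator {0..<1} t *\<^sub>R cis (?c * t)) \<in> borel_measurable lborel"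
      "(\<lambda>t. indicator {0..1} t *\<^sub>R cis (?c * t)) \<in> borel_measurable lborel"
      by measurable
  qed
  also have "\<dots> = ?F 1 - ?F 0"
  proof (rule integral_FTC_Icc)
    fix t :: real
    have "((\<lambda>t. cis (?c * t)) has_vector_derivative ?c *\<^sub>R (\<i> * cis (?c * t))) (at t within {0..1})"
      using exp_scaleR_has_vector_derivative_right [of "\<i> * of_real ?c" t "{0..1}"]
      by (simp add: cis_conv_exp scaleR_conv_of_real mult_ac)
    from has_vector_derivative_divide [OF this, of "\<i> * of_real ?c"] c
    show "(?F has_vector_derivative cis (?c * t)) (at t within {0..1})"
      by (simp add: scaleR_conv_of_real field_simps)
  qed (auto intro!: continuous_intros)
  also have "\<dots> = 0"
    by (simp add: cis_multiple_2pi)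
  finally show ?thesis using False by simp
qed

lemma finite_measure_torus_measure: "finite_measure (torus_measure d)"
proof -
  interpret product_sigma_finite "\<lambda>_::nat. restrict_space lborel {0..<1::real}"
    by (rule product_sigma_finite_unit_interval)
  have "emeasure (torus_measure d) (space (torus_measure d)) = 1"
    unfolding torus_measure_def space_PiM
    by (subst emeasure_PiM) (simp_all add: emeasure_restrict_space space_restrict_space sets_restrict_space_iff)
  then show ?thesis
    by (intro finite_measureI) simp
qed

lemma integrable_torus_char: "integrable (torus_measure d) (torus_char d k)"
proof -
  interpret product_sigma_finite "\<lambda>_::nat. restrict_space lborel {0..<1::real}"
    by (rule product_sigma_finite_unit_interval)
  show ?thesis
    unfolding torus_char_prod [abs_def] torus_measure_def
    by (intro product_integrable_prod integrable_cis_unit_interval) simp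
qed

lemma integral_torus_char:
  "(LINT x|torus_measure d. torus_char d k x) = (if \<forall>i\<in>{1..d}. k i = 0 then 1 else 0)"
proof -
  interpret product_sigma_finite "\<lambda>_::nat. restrict_space lborel {0..<1::real}"
    by (rule product_sigma_finite_unit_interval)
  have "(LINT x|torus_measure d. torus_char d k x) = (\<Prod>i\<in>{1..d}. if k i = 0 then 1 else 0)"
    unfolding torus_char_prod torus_measure_def
    by (subst product_integral_prod) (simp_all add: integrable_cis_unit_interval integral_cis_unit_interval)
  then show ?thesis by auto
qed

lemma borel_measurable_torus_char [measurable]: "torus_char d k \<in> borel_measurable (torus_measure d)"
  by (rule borel_measurable_integrable [OF integrable_torus_char])

lemma fourier_coeff_torus_char:
  assumes "k \<in> int_vectors d" "l \<in> int_vectors d"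
  shows "fourier_coeff d (torus_char d k) l = (if k = l then 1 else 0)"
proof -
  \<comment> \<open>Members of \<open>int_vectors\<close> agree outside \<open>{1..d}\<close>, so
    agreement on \<open>{1..d}\<close> is equality.\<close>
  have "(\<forall>i\<in>{1..d}. k i - l i = 0) \<longleftrightarrow> k = l"
    using assms by (auto simp: int_vectors_def intro: PiE_ext)
  then show ?thesis
    unfolding fourier_coeff_def exp_minus_dot torus_char_diff integral_torus_char by simp
qed

text \<open>On a finite measure space square integrability implies integrability, here through
  \<open>t \<le> 1 + t\<^sup>2\<close>; the unimodular factor leaves the modulus unchanged.\<close>

lemma integrable_torus_L2:
  assumes "f \<in> torus_L2 d"
  shows "integrable (torus_measure d) (\<lambda>x. f x * cnj (torus_char d k x))"
proof (rule Bochner_Integration.integrable_bound)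
  interpret finite_measure "torus_measure d" by (rule finite_measure_torus_measure)
  show "integrable (torus_measure d) (\<lambda>x. 1 + (cmod (f x))\<^sup>2)"
    using assms by (auto simp: torus_L2_def)
  have [measurable]: "f \<in> borel_measurable (torus_measure d)"
    using assms by (simp add: torus_L2_def)
  show "(\<lambda>x. f x * cnj (torus_char d k x)) \<in> borel_measurable (torus_measure d)"
    by (intro borel_measurable_times borel_measurable_continuous_on [where f = cnj] continuous_intros) measurable
  have "t \<le> 1 + t\<^sup>2" for t :: real
    using zero_le_power2 [of "t - 1 / 2"] by (simp add: power2_eq_square algebra_simps)
  then show "AE x in torus_measure d. norm (f x * cnj (torus_char d k x)) \<le> norm (1 + (cmod (f x))\<^sup>2)"
    by (simp add: norm_mult)
qed

text \<open>Membership in \<open>torus_L2\<close> supplies the integrability on which additivity of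
  the integral rests.\<close>

lemma fourier_coeff_diff:
  assumes "f \<in> torus_L2 d" "g \<in> torus_L2 d"
  shows "fourier_coeff d (\<lambda>x. f x - g x) k = fourier_coeff d f k - fourier_coeff d g k"
  unfolding fourier_coeff_def exp_minus_dot
  using assms by (simp add: left_diff_distrib integrable_torus_L2)

lemma fourier_coeff_cmult: "fourier_coeff d (\<lambda>x. c * f x) k = c * fourier_coeff d f k"
  by (simp add: fourier_coeff_def mult.assoc)

lemma torus_L2_bounded:
  assumes "f \<in> borel_measurable (torus_measure d)" "\<And>x. cmod (f x) \<le> B"
  shows "f \<in> torus_L2 d"
proof -
  interpret finite_measure "torus_measure d" by (rule finite_measure_torus_measure)
  have "(cmod (f x))\<^sup>2 \<le> B\<^sup>2" for x
    using assms(2) by (intro power_mono) auto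
  then show ?thesis
    unfolding torus_L2_def using assms(1) by (auto intro!: integrable_const_bound [of _ "B\<^sup>2"])
qed

lemma torus_char_L2: "torus_char d k \<in> torus_L2 d"
  by (rule torus_L2_bounded [of _ _ 1]) auto

section \<open>Norms and finite partial sums\<close>

lemma H_weight_nonneg: "0 \<le> H_weight d \<alpha> \<beta> k"
  unfolding H_weight_def by (intro mult_nonneg_nonneg prod_nonneg) auto

text \<open>Inside the space, a finite partial sum of a nonnegative family is at most its total;
  outside, the norm is infinite.\<close>

lemma H_norm_ge:
  assumes "finite K" "K \<subseteq> int_vectors d"
  shows "ennreal (sqrt (\<Sum>k\<in>K. (cmod (fourier_coeff d f k))\<^sup>2 * H_weight d \<alpha> \<beta> k)) \<le> H_norm d \<alpha> \<beta> f"
proof (cases "f \<in> H_space d \<alpha> \<beta>")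
  case True
  then have "(\<Sum>k\<in>K. (cmod (fourier_coeff d f k))\<^sup>2 * H_weight d \<alpha> \<beta> k) \<le>
      (\<Sum>\<^sub>\<infinity>k\<in>int_vectors d. (cmod (fourier_coeff d f k))\<^sup>2 * H_weight d \<alpha> \<beta> k)"
    using assms by (intro finite_sum_le_infsum) (auto simp: H_space_def H_weight_nonneg)
  then show ?thesis
    using True by (simp add: H_norm_def ennreal_leI)
qed (simp add: H_norm_def)

lemma H_norm_finite_spectrum:
  assumes f: "f \<in> torus_L2 d" and K: "finite K" "K \<subseteq> int_vectors d"
    and 0: "\<And>k. k \<in> int_vectors d - K \<Longrightarrow> fourier_coeff d f k = 0"
  shows "H_norm d \<alpha> \<beta> f = ennreal (sqrt (\<Sum>k\<in>K. (cmod (fourier_coeff d f k))\<^sup>2 * H_weight d \<alpha> \<beta> k))"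
proof -
  let ?g = "\<lambda>k. (cmod (fourier_coeff d f k))\<^sup>2 * H_weight d \<alpha> \<beta> k"
  have "?g summable_on int_vectors d \<longleftrightarrow> ?g summable_on K"
    by (rule summable_on_cong_neutral) (use K 0 in auto)
  moreover have "infsum ?g (int_vectors d) = infsum ?g K"
    by (rule infsum_cong_neutral) (use K 0 in auto)
  ultimately show ?thesis
    using f K by (simp add: H_norm_def H_space_def)
qed

subsection \<open>Fooling functions\<close>

text \<open>
  A function \<open>f\<close> vanishing on \<open>L\<close> and its negative have the same data, so no reconstruction \<open>h\<close>
  approximates both well: \<open>\<parallel>f - h\<parallel>\<^sup>2 + \<parallel>-f - h\<parallel>\<^sup>2 \<ge> 2 \<parallel>f\<parallel>\<^sup>2\<close> holds coefficientwise.
\<close>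

lemma samp_ge_fooling:
  assumes F: "F f \<le> 1" "F (\<lambda>x. - f x) \<le> 1"
    and f: "torus_continuous d f" "f \<in> torus_L2 d" "\<And>x. x \<in> L \<Longrightarrow> f x = 0"
    and K: "finite K" "K \<subseteq> int_vectors d"
  shows "ennreal (sqrt (\<Sum>k\<in>K. (cmod (fourier_coeff d f k))\<^sup>2 * H_weight d \<alpha> \<beta> k))
    \<le> samp d L F (H_norm d \<alpha> \<beta>)"
  unfolding samp_def
proof (rule INF_greatest)
  fix A :: "((nat \<Rightarrow> real) \<Rightarrow> complex) \<Rightarrow> (nat \<Rightarrow> real) \<Rightarrow> complex"
  let ?P = "{(f, g). F f \<le> 1 \<and> continuous_rep d f g}"
  let ?S = "SUP (f, g)\<in>?P. H_norm d \<alpha> \<beta> (\<lambda>x. f x - A (restrict g L) x)"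
  let ?q = "\<lambda>u. \<Sum>k\<in>K. (cmod (fourier_coeff d u k))\<^sup>2 * H_weight d \<alpha> \<beta> k"
  \<comment> \<open>The reconstruction from zero data is the common answer for \<open>f\<close> and
    its negative; \<open>u\<close> and \<open>v\<close> are the two errors.\<close>
  define h where "h = A (\<lambda>x\<in>L. 0)"
  define u where "u = (\<lambda>x. f x - h x)"
  define v where "v = (\<lambda>x. - f x - h x)"
  have cont: "torus_continuous d (\<lambda>x. - f x)"
    using f(1) unfolding torus_continuous_def by (intro continuous_map_minus)
  have "restrict f L = (\<lambda>x\<in>L. 0)" "(\<lambda>x\<in>L. - f x) = (\<lambda>x\<in>L. 0)"
    using f(3) by (auto simp: restrict_def)
  then have "H_norm d \<alpha> \<beta> u = H_norm d \<alpha> \<beta> (\<lambda>x. f x - A (restrict f L) x)"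
    "H_norm d \<alpha> \<beta> v = H_norm d \<alpha> \<beta> (\<lambda>x. - f x - A (\<lambda>x\<in>L. - f x) x)"
    by (simp_all add: u_def v_def h_def)
  moreover have "(f, f) \<in> ?P" "(\<lambda>x. - f x, \<lambda>x. - f x) \<in> ?P"
    using F f(1) cont by (auto simp: continuous_rep_def)
  ultimately have "H_norm d \<alpha> \<beta> u \<le> ?S" "H_norm d \<alpha> \<beta> v \<le> ?S"
    by (auto intro: SUP_upper2)
  moreover have "ennreal (sqrt (?q f)) \<le> H_norm d \<alpha> \<beta> u \<or> ennreal (sqrt (?q f)) \<le> H_norm d \<alpha> \<beta> v"
  \<comment> \<open>If both errors are square integrable, their coefficients can be subtracted;
    otherwise one of them has infinite norm.\<close>
  proof (cases "u \<in> torus_L2 d \<and> v \<in> torus_L2 d")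
    case True
    have "2 * fourier_coeff d f k = fourier_coeff d u k - fourier_coeff d v k" for k
    proof -
      have "fourier_coeff d u k - fourier_coeff d v k = fourier_coeff d (\<lambda>x. u x - v x) k"
        using True by (simp add: fourier_coeff_diff)
      \<comment> \<open>Subtracting the errors eliminates the unknown \<open>h\<close>.\<close>
      also have "(\<lambda>x. u x - v x) = (\<lambda>x. 2 * f x)"
        by (auto simp: u_def v_def)
      finally show ?thesis by (simp add: fourier_coeff_cmult)
    qed
    then have "2 * (cmod (fourier_coeff d f k))\<^sup>2 \<le>
        (cmod (fourier_coeff d u k))\<^sup>2 + (cmod (fourier_coeff d v k))\<^sup>2" for k
    proof -
      have "2 * cmod (fourier_coeff d f k) = cmod (fourier_coeff d u k - fourier_coeff d v k)"
        by (simp flip: \<open>2 * fourier_coeff d f k = _\<close> add: norm_mult)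
      also have "\<dots> \<le> cmod (fourier_coeff d u k) + cmod (fourier_coeff d v k)"
        by (rule norm_triangle_ineq4)
      finally have "(2 * cmod (fourier_coeff d f k))\<^sup>2 \<le>
          (cmod (fourier_coeff d u k) + cmod (fourier_coeff d v k))\<^sup>2"
        by (intro power_mono) auto
      moreover have "(s + t)\<^sup>2 \<le> 2 * (s\<^sup>2 + t\<^sup>2)" for s t :: real
        using zero_le_power2 [of "s - t"] by (simp add: power2_diff power2_sum)
      ultimately show ?thesis
        by (smt (verit) power_mult_distrib four_x_squared)
    qed
    then have "(\<Sum>k\<in>K. 2 * (cmod (fourier_coeff d f k))\<^sup>2 * H_weight d \<alpha> \<beta> k) \<le>
        (\<Sum>k\<in>K. ((cmod (fourier_coeff d u k))\<^sup>2 + (cmod (fourier_coeff d v k))\<^sup>2) * H_weight d \<alpha> \<beta> k)"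
      by (intro sum_mono mult_right_mono H_weight_nonneg)
    then have "2 * ?q f \<le> ?q u + ?q v"
      by (simp add: sum_distrib_left sum.distrib algebra_simps)
    \<comment> \<open>The larger of two numbers is at least their mean.\<close>
    then have "?q f \<le> ?q u \<or> ?q f \<le> ?q v"
      by linarith
    then show ?thesis
      using H_norm_ge [OF K, of u \<alpha> \<beta>] H_norm_ge [OF K, of v \<alpha> \<beta>]
      by (meson ennreal_leI order_trans real_sqrt_le_mono)
  next
    case False
    then have "u \<notin> H_space d \<alpha> \<beta> \<or> v \<notin> H_space d \<alpha> \<beta>"
      by (auto simp: H_space_def)
    then show ?thesis by (auto simp: H_norm_def)
  qed
  ultimately show "ennreal (sqrt (?q f)) \<le> ?S"
    by (meson order_trans)
qed

section \<open>Differences of two characters\<close>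

lemma torus_continuous_torus_char: "torus_continuous d (torus_char d k)"
proof -
  have "continuous_map (product_topology (\<lambda>_. euclideanreal) {1..d}) euclideanreal (dot d k)"
    unfolding dot_def by (intro continuous_intros) auto
  moreover have "continuous_map euclideanreal euclidean (\<lambda>t. cis (2 * pi * t))"
    by (auto intro!: continuous_intros)
  ultimately show ?thesis
    unfolding torus_continuous_def torus_char_frac
    unfolding torus_char_def
    using continuous_map_compose [of _ euclideanreal "dot d k" euclidean] by (auto simp: o_def)
qed


lemma torus_continuous_char_diff: "torus_continuous d (\<lambda>x. c * (torus_char d k x - torus_char d l x))"
  using torus_continuous_torus_char [of d k] torus_continuous_torus_char [of d l]
  unfolding torus_continuous_def continuous_map_atin
  by (auto intro!: tendsto_intros)

lemma char_diff_L2: "(\<lambda>x. c * (torus_char d k x - torus_char d l x)) \<in> torus_L2 d"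
proof (rule torus_L2_bounded)
  show "cmod (c * (torus_char d k x - torus_char d l x)) \<le> cmod c * 2" for x
    using norm_triangle_ineq4 [of "torus_char d k x" "torus_char d l x"]
    by (simp add: norm_mult mult_left_mono)
qed measurable

lemma fourier_coeff_char_diff:
  assumes "k \<in> int_vectors d" "l \<in> int_vectors d" "j \<in> int_vectors d"
  shows "fourier_coeff d (\<lambda>x. c * (torus_char d k x - torus_char d l x)) j =
    c * ((if k = j then 1 else 0) - (if l = j then 1 else 0))"
  using assms
  by (simp add: fourier_coeff_cmult fourier_coeff_diff torus_char_L2 fourier_coeff_torus_char)

lemma sum_fourier_coeff_char_diff:
  assumes "k \<in> int_vectors d" "l \<in> int_vectors d" "k \<noteq> l"
  shows "(\<Sum>j\<in>{k, l}. (cmod (fourier_coeff d (\<lambda>x. c * (torus_char d k x - torus_char d l x)) j))\<^sup>2 * w j)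
    = (cmod c)\<^sup>2 * (w k + w l)"
  using assms by (simp add: fourier_coeff_char_diff norm_mult distrib_left)

lemma H_norm_char_diff:
  assumes "k \<in> int_vectors d" "l \<in> int_vectors d" "k \<noteq> l"
  shows "H_norm d \<alpha> \<beta> (\<lambda>x. c * (torus_char d k x - torus_char d l x)) =
    ennreal (cmod c * sqrt (H_weight d \<alpha> \<beta> k + H_weight d \<alpha> \<beta> l))"
proof -
  have "H_norm d \<alpha> \<beta> (\<lambda>x. c * (torus_char d k x - torus_char d l x)) =
      ennreal (sqrt (\<Sum>j\<in>{k, l}. (cmod (fourier_coeff d (\<lambda>x. c * (torus_char d k x - torus_char d l x)) j))\<^sup>2
        * H_weight d \<alpha> \<beta> j))"
    using assms by (intro H_norm_finite_spectrum char_diff_L2) (auto simp: fourier_coeff_char_diff)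
  then show ?thesis
    by (simp only: sum_fourier_coeff_char_diff [OF assms]) (simp add: real_sqrt_mult)
qed

text \<open>\<open>B\<close> bounds the ratio of target to source weight at both frequencies. The
  character difference, scaled to unit source norm, vanishes on \<open>L\<close> and has squared
  target norm at least \<open>B\<close>.\<close>

lemma samp_ge_aliasing:
  assumes kl: "k \<in> int_vectors d" "l \<in> int_vectors d" "k \<noteq> l"
    and eq: "\<And>x. x \<in> L \<Longrightarrow> torus_char d k x = torus_char d l x"
    and pos: "0 < H_weight d \<alpha> \<beta> k + H_weight d \<alpha> \<beta> l"
    and le: "\<And>j. j \<in> {k, l} \<Longrightarrow> B * H_weight d \<alpha> \<beta> j \<le> H_weight d \<alpha>' \<beta>' j"
  shows "ennreal (sqrt B) \<le> samp d L (H_norm d \<alpha> \<beta>) (H_norm d \<alpha>' \<beta>')"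
proof -
  \<comment> \<open>\<open>W\<close> is the squared source norm of the unscaled difference, so the
    factor \<open>1 / sqrt W\<close> normalises it.\<close>
  define W where "W = H_weight d \<alpha> \<beta> k + H_weight d \<alpha> \<beta> l"
  define c where "c = complex_of_real (1 / sqrt W)"
  define f where "f = (\<lambda>x. c * (torus_char d k x - torus_char d l x))"
  have W: "W > 0" using pos by (simp add: W_def)
  have c: "cmod c = 1 / sqrt W" using W by (simp add: c_def norm_divide)
  \<comment> \<open>Written this way, the negative is again a multiple of the same difference, with
    a factor of the same modulus.\<close>
  have minus: "(\<lambda>x. - f x) = (\<lambda>x. - c * (torus_char d k x - torus_char d l x))"
    by (simp add: f_def)
  have "H_norm d \<alpha> \<beta> f \<le> 1" "H_norm d \<alpha> \<beta> (\<lambda>x. - f x) \<le> 1"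
    using W unfolding minus unfolding f_def H_norm_char_diff [OF kl] by (simp_all add: c flip: W_def)
  then have "ennreal (sqrt (\<Sum>j\<in>{k, l}. (cmod (fourier_coeff d f j))\<^sup>2 * H_weight d \<alpha>' \<beta>' j))
      \<le> samp d L (H_norm d \<alpha> \<beta>) (H_norm d \<alpha>' \<beta>')"
    using kl(1,2) by (intro samp_ge_fooling)
      (simp_all add: f_def torus_continuous_char_diff char_diff_L2 eq)
  moreover have "B \<le> (\<Sum>j\<in>{k, l}. (cmod (fourier_coeff d f j))\<^sup>2 * H_weight d \<alpha>' \<beta>' j)"
  proof -
    have "B * W \<le> H_weight d \<alpha>' \<beta>' k + H_weight d \<alpha>' \<beta>' l"
      using le [of k] le [of l] by (simp add: W_def distrib_left)
    then show ?thesis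
      unfolding f_def sum_fourier_coeff_char_diff [OF kl]
      using W by (simp add: c power_divide pos_le_divide_eq)
  qed
  ultimately show ?thesis
    by (meson ennreal_leI order_trans real_sqrt_le_mono)
qed

section \<open>Assembly of the lower bound\<close>

lemma axis_cross_int_vectors: "k \<in> axis_cross d R \<Longrightarrow> k \<in> int_vectors d"
  by (auto simp: axis_cross_def)

theorem mainTheorem3:
  fixes d s M :: nat and L :: "(nat \<Rightarrow> real) set"
  assumes "d \<ge> 2" and "s \<le> d" and "rank_lattice d s M L"
  shows "(\<exists>k1 \<in> axis_cross d (sqrt (real M)). \<exists>k2 \<in> axis_cross d (sqrt (real M)). k1 \<noteq> k2 \<and>
            (\<forall>x\<in>L. exp (2 * of_real pi * \<i> * of_real (dot d k1 x)) =
                   exp (2 * of_real pi * \<i> * of_real (dot d k2 x)))) \<and>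
         (\<forall>\<alpha> \<beta> \<gamma> :: real. \<alpha> > \<gamma> - \<beta> \<and> \<gamma> - \<beta> \<ge> 0 \<and> \<alpha> + \<beta> > 1/2 \<longrightarrow>
            (\<forall>Y \<in> {H_iso_norm d \<gamma>, H_mix_norm d \<gamma>}.
               samp d L (H_norm d \<alpha> \<beta>) Y \<ge>
                 ennreal (2 powr (- (\<alpha> + \<beta> - \<gamma> + 1) / 2) *
                          real M powr (- (\<alpha> + \<beta> - \<gamma>) / 2))))"
proof -
  have L: "subgroup L (torus_group d)" "finite L" and M: "M = card L"
    using assms(3) by (auto simp: rank_lattice_def)
  \<comment> \<open>A subgroup contains the unit. This lets the summand 1 be absorbed later in
    \<open>1 + n\<^sup>2 \<le> 2 * real M\<close>.\<close>
  have M1: "real M \<ge> 1"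
    using L subgroup.one_closed [OF L(1)] by (auto simp: M Suc_le_eq card_gt_0_iff)
  obtain k l where kl: "k \<in> axis_cross d (sqrt (real M))" "l \<in> axis_cross d (sqrt (real M))" "k \<noteq> l"
    and eq: "\<And>x. x \<in> L \<Longrightarrow> torus_char d k x = torus_char d l x"
    using axis_cross_aliasing [OF L assms(1)] unfolding M by blast
  \<comment> \<open>On the axes the weight depends only on the sum of its exponents, so one bound
    covers the isotropic pair \<open>(0, \<gamma>)\<close> and the mixed pair
    \<open>(\<gamma>, 0)\<close>.\<close>
  have bound: "ennreal (2 powr (- (\<alpha> + \<beta> - \<gamma> + 1) / 2) * real M powr (- (\<alpha> + \<beta> - \<gamma>) / 2))
      \<le> samp d L (H_norm d \<alpha> \<beta>) (H_norm d \<alpha>' \<beta>')"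
    if \<gamma>: "\<gamma> < \<alpha> + \<beta>" "\<alpha>' + \<beta>' = \<gamma>" for \<alpha> \<beta> \<gamma> \<alpha>' \<beta>'
  proof -
    define \<delta> where "\<delta> = \<alpha> + \<beta> - \<gamma>"
    have weight: "0 < H_weight d \<alpha> \<beta> j \<and>
        (2 * real M) powr - \<delta> * H_weight d \<alpha> \<beta> j \<le> H_weight d \<alpha>' \<beta>' j"
      if j: "j \<in> axis_cross d (sqrt (real M))" for j
    proof -
      obtain n where n: "0 \<le> n" "n \<le> sqrt (real M)"
        "\<And>\<alpha> \<beta>. H_weight d \<alpha> \<beta> j = (1 + n\<^sup>2) powr (\<alpha> + \<beta>)"
        using H_weight_axis_cross [OF j] assms(1) by auto
      have "n\<^sup>2 \<le> real M"
        using power_mono [OF n(2,1), of 2] by simp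
      then have "1 + n\<^sup>2 \<le> 2 * real M" using M1 by linarith
      moreover have "0 < 1 + n\<^sup>2" by (simp add: add_pos_nonneg)
      \<comment> \<open>As \<open>\<delta>\<close> is positive, the exponent
        \<open>- \<delta>\<close> reverses the comparison of the bases.\<close>
      ultimately have "(2 * real M) powr - \<delta> * (1 + n\<^sup>2) powr (\<alpha> + \<beta>)
          \<le> (1 + n\<^sup>2) powr - \<delta> * (1 + n\<^sup>2) powr (\<alpha> + \<beta>)"
        using \<gamma>(1) by (intro mult_right_mono powr_mono2') (auto simp: \<delta>_def)
      also have "\<dots> = (1 + n\<^sup>2) powr \<gamma>"
        by (simp add: \<delta>_def flip: powr_add)
      finally show ?thesis
        using \<gamma>(2) \<open>0 < 1 + n\<^sup>2\<close> by (simp add: n(3))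
    qed
    have "ennreal (sqrt ((2 * real M) powr - \<delta>)) \<le> samp d L (H_norm d \<alpha> \<beta>) (H_norm d \<alpha>' \<beta>')"
      using kl eq weight
      by (intro samp_ge_aliasing [of k d l]) (auto simp: add_pos_pos intro: axis_cross_int_vectors)
    \<comment> \<open>The root equals
      \<open>2 powr (- \<delta> / 2) * real M powr (- \<delta> / 2)\<close>; the claimed constant is
      smaller by a factor \<open>sqrt 2\<close>.\<close>
    moreover have "2 powr (- (\<delta> + 1) / 2) * real M powr (- \<delta> / 2) \<le> sqrt ((2 * real M) powr - \<delta>)"
    proof -
      have "2 powr (- (\<delta> + 1) / 2) \<le> 2 powr (- \<delta> / 2)"
        by (intro powr_mono) auto
      then have "2 powr (- (\<delta> + 1) / 2) * real M powr (- \<delta> / 2)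
          \<le> 2 powr (- \<delta> / 2) * real M powr (- \<delta> / 2)"
        by (intro mult_right_mono) auto
      also have "\<dots> = sqrt ((2 * real M) powr - \<delta>)"
        using M1 by (simp add: powr_mult powr_powr flip: powr_half_sqrt)
      finally show ?thesis .
    qed
    ultimately show ?thesis
      unfolding \<delta>_def by (meson ennreal_leI order_trans)
  qed
  show ?thesis
    using kl eq bound by (auto simp: exp_dot H_iso_norm_def H_mix_norm_def)
qed

end
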